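(* Let $D_L\subset\mathbb{R}^n$ be a compact, star-shaped domain containing a fixed point ${\bf x}^\ast$ of $\psi$. Define $$B({\bf x}) := A_I({\bf x})^T Y A_I({\bf x}) - Y,\qquad A_I({\bf x}) = \int_0^1 D\psi({\bf x}^\ast+s({\bf x}-{\bf x}^\ast))\,ds,$$ where $Y$ is the real symmetric matrix described in the context. Assume that $B({\bf x})$ is strictly negative definite for all ${\bf x}\in D_L$. Then $L({\bf x}) = ({\bf x}-{\bf x}^\ast)^TY({\bf x}-{\bf x}^\ast)$ is a Lyapunov function on $D_L$ for the map $\psi$. Moreover, ${\bf x}^\ast$ is the unique fixed point of $\psi$ in $D_L$.
   Context: $\psi:\mathbb{R}^n\to\mathbb{R}^n$ is a smooth map and $D\psi({\bf x})$ is its Jacobian matrix at ${\bf x}$. The matrix $Y$ is $Y=\mathrm{Re}(X^{-H}I^\ast X^{-1})$, where $X$ is a nonsingular complex $n\times n$ matrix, $X^{-H}$ is the inverse of its Hermitian transpose, and $I^\ast=\mathrm{diag}(i_1,\dots,i_n)$ with $i_k=1$ if $|\lambda_k|<1$ and $i_k=-1$ if $|\lambda_k|>1$, for complex numbers $\lambda_1,\dots,\lambda_n$ with $|\lambda_k|\neq1$. (In practice $X$ and $\lambda_k$ are numerically computed approximate eigenvectors and eigenvalues of $D\psi({\bf x}^\ast)$; no exactness is assumed.) $Y$ is real and symmetric. A real symmetric matrix $B$ is strictly negative definite if ${\bf v}^TB{\bf v}<0$ for all real ${\bf v}\ne{\bf 0}$. A continuous function $L:\mathbb{R}^n\to\mathbb{R}$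 is a Lyapunov function on a set $D$ for the map $\psi$ if (1) $L(\psi({\bf x}))\le L({\bf x})$ for all ${\bf x}\in D$; and (2) for ${\bf x}\in D$, $L(\psi({\bf x}))=L({\bf x})$ implies $\psi({\bf x})={\bf x}^\ast\in D$, where ${\bf x}^\ast$ is a fixed point of $\psi$. *)

theory Defs
  imports "HOL-Analysis.Analysis"
begin

(* f is of class C^k on the whole space: the derivatives of order up to k exist and are
   continuous, formulated through iterated directional derivatives in constant directions. *)
primrec Ck_map :: "nat \<Rightarrow> ('a::euclidean_space \<Rightarrow> 'b::euclidean_space) \<Rightarrow> bool" where
  "Ck_map 0 f \<longleftrightarrow> continuous_on UNIV f"
| "Ck_map (Suc k) f \<longleftrightarrow>
     (\<forall>x. f differentiable (at x)) \<and>
     (\<forall>v. Ck_map k (\<lambda>x. frechet_derivative f (at x) v))"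

definition smooth_map :: "('a::euclidean_space \<Rightarrow> 'b::euclidean_space) \<Rightarrow> bool" where
  "smooth_map f \<longleftrightarrow> (\<forall>k. Ck_map k f)"

definition hermitian_transpose :: "complex^'n^'m \<Rightarrow> complex^'m^'n" where
  "hermitian_transpose A = (\<chi> i j. cnj (A $ j $ i))"

(* Only used for eigenvalues with modulus different from 1; the value on the unit circle
   is arbitrary. *)
definition I_star :: "complex^'n \<Rightarrow> complex^'n^'n" where
  "I_star lam = (\<chi> j k. if j = k then (if cmod (lam $ k) < 1 then 1 else -1) else 0)"

definition Y_matrix :: "complex^'n^'n \<Rightarrow> complex^'n \<Rightarrow> real^'n^'n" where
  "Y_matrix X lam =
     (\<chi> i j. Re ((matrix_inv (hermitian_transpose X) ** I_star lam ** matrix_inv X) $ i $ j))"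

(* Used for symmetric matrices only; symmetry is not part of the predicate.  The matrices
   to which it is applied are symmetric by the lemmas at the end. *)
definition strictly_negative_definite :: "real^'n^'n \<Rightarrow> bool" where
  "strictly_negative_definite B \<longleftrightarrow> (\<forall>v. v \<noteq> 0 \<longrightarrow> v \<bullet> (B *v v) < 0)"

definition A_I :: "(real^'n \<Rightarrow> real^'n) \<Rightarrow> real^'n \<Rightarrow> real^'n \<Rightarrow> real^'n^'n" where
  "A_I \<psi> xs x = integral {0..1} (\<lambda>s. jacobian \<psi> (at (xs + s *\<^sub>R (x - xs))))"

definition B_matrix ::
  "(real^'n \<Rightarrow> real^'n) \<Rightarrow> real^'n \<Rightarrow> real^'n^'n \<Rightarrow> real^'n \<Rightarrow> real^'n^'n" where
  "B_matrix \<psi> xs Y x = transpose (A_I \<psi> xs x) ** Y ** A_I \<psi> xs x - Y"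

definition lyapunov_function_on ::
  "(real^'n \<Rightarrow> real^'n) \<Rightarrow> real^'n \<Rightarrow> (real^'n) set \<Rightarrow> (real^'n \<Rightarrow> real) \<Rightarrow> bool" where
  "lyapunov_function_on \<psi> xs D L \<longleftrightarrow>
     continuous_on UNIV L \<and> \<psi> xs = xs \<and>
     (\<forall>x\<in>D. L (\<psi> x) \<le> L x) \<and>
     (\<forall>x\<in>D. L (\<psi> x) = L x \<longrightarrow> \<psi> x = xs \<and> xs \<in> D)"

lemma hermitian_transpose_mult:
  "hermitian_transpose (A ** B) = hermitian_transpose B ** hermitian_transpose A"
  by (simp add: hermitian_transpose_def matrix_matrix_mult_def vec_eq_iff mult.commute)

lemma matrix_inv_hermitian_transpose:
  fixes X :: "complex^'n^'n"
  assumes "invertible X"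
  shows "matrix_inv (hermitian_transpose X) = hermitian_transpose (matrix_inv X)"
proof -
  have one: "hermitian_transpose (mat 1) = (mat 1 :: complex^'n^'n)"
    by (auto simp: hermitian_transpose_def mat_def vec_eq_iff)
  have inv: "X ** matrix_inv X = mat 1" "matrix_inv X ** X = mat 1"
    using someI_ex[OF assms[unfolded invertible_def]] unfolding matrix_inv_def by simp_all
  have H: "hermitian_transpose X ** hermitian_transpose (matrix_inv X) = mat 1"
    "hermitian_transpose (matrix_inv X) ** hermitian_transpose X = mat 1"
    by (simp_all flip: hermitian_transpose_mult add: inv one)
  then have "invertible (hermitian_transpose X)"
    unfolding invertible_def by blast
  from someI_ex[OF this[unfolded invertible_def]]
  have L: "matrix_inv (hermitian_transpose X) ** hermitian_transpose X = mat 1"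
    unfolding matrix_inv_def by simp
  have "matrix_inv (hermitian_transpose X) =
      matrix_inv (hermitian_transpose X) ** (hermitian_transpose X ** hermitian_transpose (matrix_inv X))"
    by (simp add: H)
  also have "\<dots> = hermitian_transpose (matrix_inv X)"
    by (simp add: matrix_mul_assoc L)
  finally show ?thesis .
qed

lemma symmetric_Y_matrix:
  fixes X :: "complex^'n^'n"
  assumes "invertible X"
  shows "transpose (Y_matrix X lam) = Y_matrix X lam"
proof -
  let ?M = "matrix_inv (hermitian_transpose X) ** I_star lam ** matrix_inv X"
  have "hermitian_transpose (I_star lam) = I_star lam"
    by (auto simp: hermitian_transpose_def I_star_def vec_eq_iff)
  moreover have "hermitian_transpose (hermitian_transpose A) = A" for A :: "complex^'n^'n"
    by (simp add: hermitian_transpose_def vec_eq_iff)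
  ultimately have "hermitian_transpose ?M = ?M"
    by (simp add: matrix_inv_hermitian_transpose[OF assms] hermitian_transpose_mult
        matrix_mul_assoc)
  then have "cnj (?M $ j $ i) = ?M $ i $ j" for i j
    unfolding hermitian_transpose_def vec_eq_iff by simp
  then have "Re (?M $ j $ i) = Re (?M $ i $ j)" for i j
    by (metis cnj.simps(1))
  then show ?thesis
    by (simp add: transpose_def Y_matrix_def vec_eq_iff)
qed

lemma symmetric_B_matrix:
  fixes Y :: "real^'n^'n"
  assumes "transpose Y = Y"
  shows "transpose (B_matrix \<psi> xs Y x) = B_matrix \<psi> xs Y x"
proof -
  have "transpose (P - Q) = transpose P - transpose Q" for P Q :: "real^'n^'n"
    by (simp add: transpose_def vec_eq_iff)
  then show ?thesis
    by (simp add: B_matrix_def matrix_transpose_mul assms matrix_mul_assoc)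
qed

end

theory Submission
  imports Defs
begin

text \<open>By the fundamental theorem of calculus along the segment from the fixed point
  \<open>xs\<close> to \<open>x\<close>, the averaged Jacobian satisfies \<open>\<psi> x - xs = A_I \<psi> xs x *v (x - xs)\<close>. Hence
  \<open>L (\<psi> x) - L x\<close> is exactly the quadratic form of \<open>B_matrix \<psi> xs Y x\<close> at \<open>x - xs\<close>, which is
  negative unless \<open>x = xs\<close>; a second fixed point would make this difference zero.\<close>

lemma smooth_map_differentiable: "smooth_map f \<Longrightarrow> f differentiable (at x)"
  unfolding smooth_map_def by (metis Ck_map.simps(2))

lemma smooth_map_continuous_on_frechet_derivative:
  assumes "smooth_map f"
  shows "continuous_on UNIV (\<lambda>x. frechet_derivative f (at x) v)"
proof -
  have "Ck_map (Suc 0) f"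
    using assms unfolding smooth_map_def by blast
  then show ?thesis
    by simp
qed

text \<open>Column \<open>j\<close> of the Jacobian is the derivative in the constant direction
  \<open>axis j 1\<close>, so continuity for each fixed direction gives it entry by entry.\<close>

lemma smooth_map_continuous_on_jacobian:
  fixes f :: "real^'n \<Rightarrow> real^'m"
  assumes "smooth_map f"
  shows "continuous_on UNIV (\<lambda>x. jacobian f (at x))"
  unfolding jacobian_def matrix_def
  by (intro continuous_on_vec_lambda continuous_on_component
      smooth_map_continuous_on_frechet_derivative assms)

text \<open>Allows multiplication by a fixed vector to be pulled inside a matrix-valued
  integral.\<close>

lemma bounded_linear_matrix_vector_mult_left:
  fixes v :: "real^'n"
  shows "bounded_linear (\<lambda>A :: real^'n^'m. A *v v)"
  unfolding linear_conv_bounded_linear[symmetric]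
  by (intro linearI)
    (simp_all add: matrix_vector_mult_add_rdistrib scaleR_matrix_vector_assoc)

lemma A_I_mult:
  fixes \<psi> :: "real^'n \<Rightarrow> real^'n"
  assumes "smooth_map \<psi>"
  shows "A_I \<psi> xs x *v (x - xs) = \<psi> x - \<psi> xs"
proof -
  define p where "p s = xs + s *\<^sub>R (x - xs)" for s
  have "continuous_on {0..1} (\<lambda>s. jacobian \<psi> (at (p s)))"
    unfolding p_def
    by (rule continuous_on_compose2[OF smooth_map_continuous_on_jacobian[OF assms]])
      (auto intro!: continuous_intros)
  then have "((\<lambda>s. jacobian \<psi> (at (p s))) has_integral A_I \<psi> xs x) {0..1}"
    unfolding A_I_def p_def by (intro integrable_integral integrable_continuous_real)
  from has_integral_linear[OF this bounded_linear_matrix_vector_mult_left]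
  have 1: "((\<lambda>s. jacobian \<psi> (at (p s)) *v (x - xs)) has_integral A_I \<psi> xs x *v (x - xs)) {0..1}"
    by (simp add: o_def)
  have "((\<lambda>s. jacobian \<psi> (at (p s)) *v (x - xs)) has_integral \<psi> (p 1) - \<psi> (p 0)) {0..1}"
  proof (rule fundamental_theorem_of_calculus)
    fix s :: real
    have "(p has_vector_derivative x - xs) (at s within {0..1})"
      unfolding p_def by (auto intro!: derivative_eq_intros)
    moreover have "(\<psi> has_derivative (\<lambda>h. jacobian \<psi> (at (p s)) *v h)) (at (p s))"
      using jacobian_works smooth_map_differentiable[OF assms] by blast
    \<comment> \<open>Chain rule along the segment; its form within a set needs the derivative of
      \<open>\<psi>\<close> only within the image of \<open>{0..1}\<close> under
      \<open>p\<close>.\<close>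
    ultimately show
      "((\<lambda>s. \<psi> (p s)) has_vector_derivative jacobian \<psi> (at (p s)) *v (x - xs)) (at s within {0..1})"
      using vector_derivative_diff_chain_within[of p _ s "{0..1}" \<psi>] has_derivative_at_withinI
      by (fastforce simp: o_def)
  qed simp
  then show ?thesis
    using has_integral_unique[OF 1] by (simp add: p_def)
qed

text \<open>The transposed factor moves across the inner product: v . (A^T w) = (A v) . w.\<close>

lemma B_matrix_quadratic_form:
  "v \<bullet> (B_matrix \<psi> xs Y x *v v) =
   (A_I \<psi> xs x *v v) \<bullet> (Y *v (A_I \<psi> xs x *v v)) - v \<bullet> (Y *v v)"
  unfolding B_matrix_def
  by (simp add: matrix_vector_mult_diff_rdistrib inner_diff_right dot_lmul_matrix
      flip: matrix_vector_mul_assoc)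
    (metis dot_lmul_matrix vector_transpose_matrix transpose_transpose)

theorem theorem4p2:
  fixes \<psi> :: "real^'n \<Rightarrow> real^'n"
    and xs :: "real^'n"
    and D :: "(real^'n) set"
    and X :: "complex^'n^'n"
    and lam :: "complex^'n"
    and Y :: "real^'n^'n"
  assumes "smooth_map \<psi>"
    and "invertible X"
    and "\<forall>k. cmod (lam $ k) \<noteq> 1"
    and "Y = Y_matrix X lam"
    and "compact D" and "starlike D"
    and "xs \<in> D" and "\<psi> xs = xs"
    and "\<forall>x\<in>D. strictly_negative_definite (B_matrix \<psi> xs Y x)"
  shows "lyapunov_function_on \<psi> xs D (\<lambda>x. (x - xs) \<bullet> (Y *v (x - xs))) \<and>
         {x \<in> D. \<psi> x = x} = {xs}"
proof -
  let ?L = "\<lambda>x. (x - xs) \<bullet> (Y *v (x - xs))"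
  have decrease: "?L (\<psi> x) < ?L x" if "x \<in> D" "x \<noteq> xs" for x
  proof -
    have "(x - xs) \<bullet> (B_matrix \<psi> xs Y x *v (x - xs)) < 0"
      using assms(9) that unfolding strictly_negative_definite_def by simp
    then show ?thesis
      \<comment> \<open>Since \<open>\<psi> xs = xs\<close>, the vector
        \<open>A_I \<psi> xs x *v (x - xs)\<close> is \<open>\<psi> x - xs\<close>, so the form
        splits into \<open>?L (\<psi> x) - ?L x\<close>.\<close>
      by (simp add: B_matrix_quadratic_form A_I_mult[OF assms(1)] assms(8))
  qed
  have "continuous_on UNIV ?L"
    by (intro continuous_intros linear_continuous_on_compose[OF _ matrix_vector_mul_linear])
  moreover have "?L (\<psi> x) \<le> ?L x" if "x \<in> D" for x
    using decrease[OF that] assms(8) by (cases "x = xs") auto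
  \<comment> \<open>Strict decrease rules out equality away from \<open>xs\<close>, so
    \<open>x = xs\<close>, which \<open>\<psi>\<close> fixes.\<close>
  moreover have "\<psi> x = xs" if "x \<in> D" "?L (\<psi> x) = ?L x" for x
    using decrease[of x] that assms(8) by (cases "x = xs") auto
  moreover have "x = xs" if "x \<in> D" "\<psi> x = x" for x
    using decrease[of x] that by auto
  ultimately show ?thesis
    using assms(7,8) unfolding lyapunov_function_on_def by blast
qed

end
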